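(* Let $A$ be an ordered semiring, $F$ a frame and $f\colon A\to F$ a subadditive morphism, where $F$ is regarded as the ordered semiring $(F,\leq,\bot,\top,\vee,\wedge)$. Then there exists a unique frame homomorphism $g\colon\mathrm{Rad}(A)\to F$ such that $g\bigl(\sqrt{\langle x\rangle}\bigr)=f(x)$ for all $x\in A$, where $\mathrm{Rad}(A)$ is the frame of radical ideals of $A$ and $\sqrt{\langle x\rangle}$ is the smallest radical ideal of $A$ containing $x$.
   Context: Semirings are commutative and unital: $(A,0,+)$ and $(A,1,\cdot)$ are commutative monoids with $x\cdot 0=0$ and $x(y+z)=xy+xz$. An ordered semiring is a tuple $(A,\leq,0,1,+,\cdot)$ where $(A,0,1,+,\cdot)$ is a semiring and $\leq$ is a preorder on $A$ with respect to which $+$ and $\cdot$ are monotone. A subadditive morphism $f\colon A\to B$ between ordered semirings is a monotone function with $f(0_A)\leq 0_B$, $f(1_A)=1_B$, $f(x+y)\leq f(x)+f(y)$ and $f(xy)=f(x)f(y)$ for all $x,y\in A$. A frame is a complete lattice $(F,\leq)$ in which $x\wedge\bigvee_\lambda y_\lambda=\bigvee_\lambda (x\wedge y_\lambda)$ for all $x\in F$ and all families $(y_\lambda)$. A frame homomorphism is a function preserving arbitrary joins and finite meets. Any frame is regarded as an ordered semiring $(F,\leq,\bot,\top,\vee,\wedge)$. An ideal of an ordered semiring $A$ is a subset $I\subseteq A$ such that: $x\leq y\in I$ implies $x\in I$; $0\in I$; $x,y\in I$ implies $x+y\in I$; and if $x\in I$ or $y\in I$ then $xy\in I$. $\langle x\rangle$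 is the smallest ideal containing $x$. An ideal $I$ is radical if for all $x\in A$ and $n\in\mathbb{N}$, $x^n\in I$ implies $x\in I$. Radical ideals are closed under arbitrary intersections, and for an ideal $I$, $\sqrt{I}$ denotes the smallest radical ideal containing $I$. $\mathrm{Rad}(A)$ is the set of all radical ideals of $A$ ordered by inclusion; it is a frame. *)

theory Defs
  imports Complex_Main "HOL.Hull"
begin

section \<open>Ordered semirings and subadditive morphisms\<close>

text \<open>
  Explicit operations are used here, because every frame is to be regarded as an ordered
  semiring as well.  The preorder is not required to be antisymmetric, and zero and one may
  coincide.
\<close>

locale ord_semiring =
  fixes le :: "'a \<Rightarrow> 'a \<Rightarrow> bool"
    and zero one :: 'a
    and add mult :: "'a \<Rightarrow> 'a \<Rightarrow> 'a"
  assumes le_refl: "le x x"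
    and le_trans: "le x y \<Longrightarrow> le y z \<Longrightarrow> le x z"
    and add: "comm_monoid add zero"
    and mult: "comm_monoid mult one"
    and mult_zero: "mult x zero = zero"
    and distrib: "mult x (add y z) = add (mult x y) (mult x z)"
    and add_mono: "le x x' \<Longrightarrow> le y y' \<Longrightarrow> le (add x y) (add x' y')"
    and mult_mono: "le x x' \<Longrightarrow> le y y' \<Longrightarrow> le (mult x y) (mult x' y')"

locale subadditive_morphism =
  A: ord_semiring leA zeroA oneA addA multA + B: ord_semiring leB zeroB oneB addB multB
  for leA :: "'a \<Rightarrow> 'a \<Rightarrow> bool" and zeroA oneA addA multA
    and leB :: "'b \<Rightarrow> 'b \<Rightarrow> bool" and zeroB oneB addB multB +
  fixes f :: "'a \<Rightarrow> 'b"
  assumes mono: "leA x y \<Longrightarrow> leB (f x) (f y)"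
    and zero: "leB (f zeroA) zeroB"
    and one: "f oneA = oneB"
    and add: "leB (f (addA x y)) (addB (f x) (f y))"
    and mult: "f (multA x y) = multB (f x) (f y)"

text \<open>
  The class version of ordered semirings.  The library class \<open>comm_semiring_1\<close> is avoided
  since it excludes the trivial semiring; the library's ordered semirings are avoided since
  their order is antisymmetric.
\<close>

class preordered_comm_semiring = comm_semiring_0 + comm_monoid_mult + preorder +
  assumes preordered_add_mono: "x \<le> x' \<Longrightarrow> y \<le> y' \<Longrightarrow> x + y \<le> x' + y'"
    and preordered_mult_mono: "x \<le> x' \<Longrightarrow> y \<le> y' \<Longrightarrow> x * y \<le> x' * y'"

lemma ord_semiring_class:
  "ord_semiring (\<le>) 0 1 (+) ((*) :: 'a \<Rightarrow> 'a \<Rightarrow> 'a::preordered_comm_semiring)"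
  by unfold_locales
    (auto intro: preordered_add_mono preordered_mult_mono simp: distrib_left ac_simps
      dest: order_trans)

lemma ord_semiring_imp_class:
  assumes "ord_semiring le zero one add mult"
  shows "class.preordered_comm_semiring mult one le (\<lambda>x y. le x y \<and> \<not> le y x) add zero"
proof -
  interpret ord_semiring le zero one add mult by fact
  interpret a: comm_monoid add zero by (rule add)
  interpret m: comm_monoid mult one by (rule mult)
  show ?thesis
  proof unfold_locales
    fix x y z assume "le x y" "le y z" then show "le x z" by (rule le_trans)
  next
    fix x y z show "mult (add x y) z = add (mult x z) (mult y z)"
      by (metis distrib m.commute)
  next
    fix x show "mult zero x = zero" by (metis mult_zero m.commute)
  qed (rule a.assoc m.assoc a.commute m.commute a.left_neutral m.left_neutral refl
      mult_zero le_refl add_mono mult_mono; assumption)+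
qed


section \<open>Frames\<close>

class frame = complete_lattice +
  assumes inf_Sup_distrib: "inf x (Sup Y) = (SUP y\<in>Y. inf x y)"

lemma ord_semiring_frame:
  "ord_semiring (\<le>) bot top sup (inf :: 'a \<Rightarrow> 'a \<Rightarrow> 'a::frame)"
proof -
  have *: "inf x (sup y z) = sup (inf x y) (inf x z)" for x y z :: 'a
    using inf_Sup_distrib[of x "{y, z}"] by simp
  show ?thesis
    by unfold_locales
      (rule order_refl sup_assoc inf_assoc sup_commute inf_commute sup_bot_right inf_top_right
        inf_bot_right * sup_mono inf_mono | erule order_trans | assumption)+
qed

definition frame_hom :: "('a::frame \<Rightarrow> 'b::frame) \<Rightarrow> bool" where
  "frame_hom g \<longleftrightarrow>
     (\<forall>X. g (Sup X) = Sup (g ` X)) \<and> (\<forall>X. finite X \<longrightarrow> g (Inf X) = Inf (g ` X))"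


section \<open>Ideals and radical ideals\<close>

definition ideal :: "'a::preordered_comm_semiring set \<Rightarrow> bool" where
  "ideal I \<longleftrightarrow>
     (\<forall>x y. x \<le> y \<and> y \<in> I \<longrightarrow> x \<in> I) \<and>
     0 \<in> I \<and>
     (\<forall>x y. x \<in> I \<and> y \<in> I \<longrightarrow> x + y \<in> I) \<and>
     (\<forall>x y. x \<in> I \<or> y \<in> I \<longrightarrow> x * y \<in> I)"

definition radical_ideal :: "'a::preordered_comm_semiring set \<Rightarrow> bool" where
  "radical_ideal I \<longleftrightarrow> ideal I \<and> (\<forall>x. \<forall>n::nat. x ^ n \<in> I \<longrightarrow> x \<in> I)"

lemma ideal_Inter: "(\<And>I. I \<in> \<I> \<Longrightarrow> ideal I) \<Longrightarrow> ideal (\<Inter>\<I>)"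
  unfolding ideal_def by blast

lemma radical_ideal_Inter: "(\<And>I. I \<in> \<I> \<Longrightarrow> radical_ideal I) \<Longrightarrow> radical_ideal (\<Inter>\<I>)"
  unfolding radical_ideal_def using ideal_Inter by blast

lemma ideal_hull: "ideal (ideal hull S)"
  by (rule hull_in) (auto intro: ideal_Inter)

lemma radical_ideal_hull: "radical_ideal (radical_ideal hull S)"
  by (rule hull_in) (auto intro: radical_ideal_Inter)

lemma radical_ideal_hull_ideal_hull:
  "radical_ideal hull (ideal hull S) = radical_ideal hull S"
proof (rule hull_unique)
  show "ideal hull S \<subseteq> radical_ideal hull S"
    using radical_ideal_hull[of S] by (intro hull_minimal hull_subset) (simp add: radical_ideal_def)
  show "radical_ideal (radical_ideal hull S)" by (rule radical_ideal_hull)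
  show "radical_ideal hull S \<subseteq> t'" if "ideal hull S \<subseteq> t'" "radical_ideal t'" for t'
    using that by (meson hull_minimal hull_subset subset_trans)
qed

lemma radical_ideal_mult:
  assumes "radical_ideal I" "x \<in> I \<or> y \<in> I"
  shows "x * y \<in> I"
  using assms unfolding radical_ideal_def ideal_def by blast

lemma radical_ideal_quotient:
  assumes I: "radical_ideal I" and R: "radical_ideal R"
  shows "radical_ideal {z. \<forall>i\<in>I. z * i \<in> R}"
proof -
  have le: "x \<in> R" if "x \<le> y" "y \<in> R" for x y
    using R that unfolding radical_ideal_def ideal_def by blast
  have mult: "x * y \<in> R" if "x \<in> R" for x y
    using R that unfolding radical_ideal_def ideal_def by blast
  have zero: "0 \<in> R"
    using R unfolding radical_ideal_def ideal_def by blast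
  have add: "x + y \<in> R" if "x \<in> R" "y \<in> R" for x y
    using R that unfolding radical_ideal_def ideal_def by blast
  have rad: "z * i \<in> R" if z: "\<forall>i\<in>I. z ^ n * i \<in> R" and i: "i \<in> I" for z i n
  proof -
    have "(z ^ n * i) * (z * i ^ n) \<in> R" using z i mult by blast
    also have "(z ^ n * i) * (z * i ^ n) = (z * i) ^ Suc n"
      by (simp add: power_mult_distrib ac_simps)
    finally show ?thesis using R unfolding radical_ideal_def by blast
  qed
  show ?thesis
    unfolding radical_ideal_def ideal_def
  proof (intro conjI allI impI; (elim conjE)?)
    fix x y assume "x \<le> y" and y: "y \<in> {z. \<forall>i\<in>I. z * i \<in> R}"
    then have "x * i \<le> y * i" for i by (intro preordered_mult_mono order_refl)
    moreover have "y * i \<in> R" if "i \<in> I" for i using y that by simp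
    ultimately have "x * i \<in> R" if "i \<in> I" for i using le that by blast
    then show "x \<in> {z. \<forall>i\<in>I. z * i \<in> R}" by simp
  next
    show "0 \<in> {z. \<forall>i\<in>I. z * i \<in> R}"
      by (simp add: zero)
  next
    fix x y assume "x \<in> {z. \<forall>i\<in>I. z * i \<in> R}" "y \<in> {z. \<forall>i\<in>I. z * i \<in> R}"
    then show "x + y \<in> {z. \<forall>i\<in>I. z * i \<in> R}"
      by (simp add: distrib_right add)
  next
    fix x y assume xy: "x \<in> {z. \<forall>i\<in>I. z * i \<in> R} \<or> y \<in> {z. \<forall>i\<in>I. z * i \<in> R}"
    have "x * y * i \<in> R" if "i \<in> I" for i
    proof -
      have eq: "x * y * i = (x * i) * y" "x * y * i = (y * i) * x" by (simp_all add: ac_simps)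
      from xy that have "x * i \<in> R \<or> y * i \<in> R" by blast
      then show ?thesis
      proof
        assume "x * i \<in> R"
        then show ?thesis unfolding eq(1) by (rule mult)
      next
        assume "y * i \<in> R"
        then show ?thesis unfolding eq(2) by (rule mult)
      qed
    qed
    then show "x * y \<in> {z. \<forall>i\<in>I. z * i \<in> R}" by blast
  next
    fix x and n :: nat assume "x ^ n \<in> {z. \<forall>i\<in>I. z * i \<in> R}"
    then show "x \<in> {z. \<forall>i\<in>I. z * i \<in> R}" using rad by blast
  qed
qed

lemma Int_hull_Union_subset:
  assumes I: "radical_ideal I" and Y: "\<And>J. J \<in> Y \<Longrightarrow> radical_ideal J"
  shows "I \<inter> (radical_ideal hull \<Union>Y) \<subseteq> radical_ideal hull (\<Union>J\<in>Y. I \<inter> J)"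
proof
  let ?R = "radical_ideal hull (\<Union>J\<in>Y. I \<inter> J)"
  have R: "radical_ideal ?R" by (rule radical_ideal_hull)
  fix z assume z: "z \<in> I \<inter> (radical_ideal hull \<Union>Y)"
  have "z' * i \<in> ?R" if "z' \<in> J" "J \<in> Y" "i \<in> I" for z' i J
  proof -
    have "z' * i \<in> I \<inter> J"
      using radical_ideal_mult[OF I] radical_ideal_mult[OF Y[OF that(2)]] that by simp
    with that(2) have "z' * i \<in> (\<Union>J\<in>Y. I \<inter> J)" by (rule UN_I)
    then show ?thesis by (rule hull_inc)
  qed
  then have "\<Union>Y \<subseteq> {z. \<forall>i\<in>I. z * i \<in> ?R}" by blast
  then have "radical_ideal hull \<Union>Y \<subseteq> {z. \<forall>i\<in>I. z * i \<in> ?R}"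
    by (rule hull_minimal) (rule radical_ideal_quotient[OF I R])
  with z have "z * z \<in> ?R" by blast
  then have "z ^ 2 \<in> ?R" by (simp only: power2_eq_square)
  then show "z \<in> ?R" using R unfolding radical_ideal_def by blast
qed


section \<open>The frame of radical ideals\<close>

typedef (overloaded) 'a rad = "{I :: 'a::preordered_comm_semiring set. radical_ideal I}"
  by (rule exI[of _ UNIV]) (simp add: radical_ideal_def ideal_def)

setup_lifting type_definition_rad

text \<open>
  For an ideal \<open>I\<close>, \<open>radical I\<close> is the smallest radical ideal containing \<open>I\<close>, as an element
  of the type of radical ideals.
\<close>

lift_definition radical :: "'a::preordered_comm_semiring set \<Rightarrow> 'a rad"
  is "\<lambda>I. radical_ideal hull I"
  by (rule radical_ideal_hull)

instantiation rad :: (preordered_comm_semiring) frame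
begin

lift_definition less_eq_rad :: "'a rad \<Rightarrow> 'a rad \<Rightarrow> bool" is "(\<subseteq>)" .
lift_definition less_rad :: "'a rad \<Rightarrow> 'a rad \<Rightarrow> bool" is "(\<subset>)" .
lift_definition bot_rad :: "'a rad" is "radical_ideal hull {}"
  by (rule radical_ideal_hull)
lift_definition top_rad :: "'a rad" is "UNIV"
  by (simp add: radical_ideal_def ideal_def)
lift_definition inf_rad :: "'a rad \<Rightarrow> 'a rad \<Rightarrow> 'a rad" is "(\<inter>)"
  subgoal for I J
    using radical_ideal_Inter[of "{I, J}"] by auto
  done
lift_definition sup_rad :: "'a rad \<Rightarrow> 'a rad \<Rightarrow> 'a rad" is "\<lambda>I J. radical_ideal hull (I \<union> J)"
  by (rule radical_ideal_hull)
lift_definition Inf_rad :: "'a rad set \<Rightarrow> 'a rad" is "\<lambda>\<I>. \<Inter>\<I>"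
  by (rule radical_ideal_Inter)
lift_definition Sup_rad :: "'a rad set \<Rightarrow> 'a rad" is "\<lambda>\<I>. radical_ideal hull (\<Union>\<I>)"
  by (rule radical_ideal_hull)

instance
proof
  fix x y z :: "'a rad" and X :: "'a rad set"
  show "(x < y) = (x \<le> y \<and> \<not> y \<le> x)" by transfer auto
  show "x \<le> x" by transfer auto
  show "x \<le> y \<Longrightarrow> y \<le> z \<Longrightarrow> x \<le> z" by transfer auto
  show "x \<le> y \<Longrightarrow> y \<le> x \<Longrightarrow> x = y" by transfer auto
  show "inf x y \<le> x" "inf x y \<le> y" by (transfer; auto)+
  show "x \<le> y \<Longrightarrow> x \<le> z \<Longrightarrow> x \<le> inf y z" by transfer auto
  show "x \<le> sup x y" "y \<le> sup x y" by (transfer; auto intro: hull_inc)+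
  show "y \<le> x \<Longrightarrow> z \<le> x \<Longrightarrow> sup y z \<le> x" by transfer (intro hull_minimal Un_least)
  show "x \<in> X \<Longrightarrow> Inf X \<le> x" by transfer auto
  show "(\<And>x. x \<in> X \<Longrightarrow> z \<le> x) \<Longrightarrow> z \<le> Inf X" by transfer blast
  show "x \<in> X \<Longrightarrow> x \<le> Sup X" by transfer (auto intro: hull_inc)
  show "(\<And>x. x \<in> X \<Longrightarrow> x \<le> z) \<Longrightarrow> Sup X \<le> z"
    by transfer (rule hull_minimal, auto)
  show "Inf {} = (top :: 'a rad)" by transfer simp
  show "Sup {} = (bot :: 'a rad)" by transfer simp
  show "inf x (Sup X) = (SUP y\<in>X. inf x y)"
  proof transfer
    fix I :: "'a set" and Y :: "'a set set"
    assume I: "radical_ideal I" and "Ball Y radical_ideal"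
    then have Y: "\<And>J. J \<in> Y \<Longrightarrow> radical_ideal J" by blast
    show "I \<inter> (radical_ideal hull \<Union>Y) = radical_ideal hull \<Union>((\<inter>) I ` Y)"
    proof
      show "I \<inter> (radical_ideal hull \<Union>Y) \<subseteq> radical_ideal hull \<Union>((\<inter>) I ` Y)"
        using Int_hull_Union_subset[OF I Y] by simp
      show "radical_ideal hull \<Union>((\<inter>) I ` Y) \<subseteq> I \<inter> (radical_ideal hull \<Union>Y)"
        by (intro Int_greatest hull_minimal[where S = radical_ideal, OF _ I] hull_mono) auto
    qed
  qed
qed

end

end

theory Submission
  imports Defs
begin

text \<open>
  The homomorphism is \<open>g I = (SUP x\<in>I. f x)\<close>.  The key point is that for every \<open>c\<close> in the
  frame \<open>{x. f x \<le> c}\<close> is a radical ideal, so that passing from a set to the radical ideal it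
  generates does not change the supremum of \<open>f\<close>.  Hence \<open>g\<close> preserves joins and sends
  \<open>\<surd>\<langle>x\<rangle>\<close> to \<open>f x\<close>; it preserves binary meets since \<open>f x \<sqinter> f y = f (x y)\<close>.  Uniqueness
  holds as every radical ideal is the join of the radical ideals generated by its elements.
\<close>

text \<open>Frame distributivity, applied once in each argument, reduces a bound on a meet of two
  joins to bounds on meets of members. Since \<open>inf_Sup_distrib\<close> acts on the right
  argument only, commutativity swaps the roles in between.\<close>

lemma Sup_inf_Sup_le:
  fixes c :: "'f::frame"
  assumes "\<And>x y. x \<in> X \<Longrightarrow> y \<in> Y \<Longrightarrow> inf x y \<le> c"
  shows "inf (Sup X) (Sup Y) \<le> c"
proof -
  have "inf y (Sup X) \<le> c" if "y \<in> Y" for y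
    unfolding inf_Sup_distrib using assms that by (intro SUP_least) (simp add: inf_commute)
  then have "inf (Sup X) y \<le> c" if "y \<in> Y" for y
    using that by (simp add: inf_commute)
  then show ?thesis
    unfolding inf_Sup_distrib[of "Sup X" Y] by (rule SUP_least)
qed

lemma frame_homI:
  fixes g :: "'a::frame \<Rightarrow> 'b::frame"
  assumes Sup: "\<And>X. g (Sup X) = Sup (g ` X)"
    and top: "g top = top"
    and inf: "\<And>x y. g (inf x y) = inf (g x) (g y)"
  shows "frame_hom g"
proof -
  have "g (Inf X) = Inf (g ` X)" if "finite X" for X
    using that by (induction X) (simp_all add: top inf)
  then show ?thesis
    using Sup unfolding frame_hom_def by blast
qed

lemma radical_ideal_le_vimage:
  fixes f :: "'a::preordered_comm_semiring \<Rightarrow> 'f::frame"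
  assumes f: "subadditive_morphism (\<le>) 0 1 (+) (*) (\<le>) bot top sup inf f"
  shows "radical_ideal {x. f x \<le> c}"
proof -
  have mono: "f x \<le> f y" if "x \<le> y" for x y
    using subadditive_morphism.mono[OF f that] .
  have add: "f (x + y) \<le> sup (f x) (f y)" for x y
    using subadditive_morphism.add[OF f] .
  have mult: "f (x * y) = inf (f x) (f y)" for x y
    using subadditive_morphism.mult[OF f] .
  have zero: "f 0 \<le> c"
    using subadditive_morphism.zero[OF f] by (rule order_trans) simp
  \<comment> \<open>For \<open>n = 0\<close> the right side is \<open>f 1 = top\<close>; in the
    successor step \<open>f (x ^ Suc n)\<close> is the meet of \<open>f x\<close> with
    \<open>f (x ^ n)\<close>, and both lie above \<open>f x\<close>.\<close>
  have power: "f x \<le> f (x ^ n)" for x n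
    by (induction n) (simp_all add: subadditive_morphism.one[OF f] mult)
  show ?thesis
    unfolding radical_ideal_def ideal_def mem_Collect_eq
  proof (intro conjI allI impI)
    show "f x \<le> c" if "x \<le> y \<and> f y \<le> c" for x y
      using that mono order_trans by blast
    show "f (x + y) \<le> c" if "f x \<le> c \<and> f y \<le> c" for x y
      using that by (intro order_trans[OF add]) simp
    show "f (x * y) \<le> c" if "f x \<le> c \<or> f y \<le> c" for x y
      using that by (auto simp: mult intro: le_infI1 le_infI2)
    show "f x \<le> c" if "f (x ^ n) \<le> c" for x n
      using power that by (rule order_trans)
  qed (rule zero)
qed

lemma SUP_radical_ideal_hull:
  fixes f :: "'a::preordered_comm_semiring \<Rightarrow> 'f::frame"
  assumes "subadditive_morphism (\<le>) 0 1 (+) (*) (\<le>) bot top sup inf f"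
  shows "(SUP x\<in>radical_ideal hull S. f x) = (SUP x\<in>S. f x)"
proof (rule antisym)
  \<comment> \<open>The bound \<open>c\<close> is chosen as the join over the generators, so the
    radical ideal of elements below it contains \<open>S\<close>.\<close>
  have "radical_ideal hull S \<subseteq> {x. f x \<le> (SUP x\<in>S. f x)}"
    by (rule hull_minimal) (auto intro: SUP_upper radical_ideal_le_vimage[OF assms])
  then show "(SUP x\<in>radical_ideal hull S. f x) \<le> (SUP x\<in>S. f x)"
    by (auto intro: SUP_least)
  show "(SUP x\<in>S. f x) \<le> (SUP x\<in>radical_ideal hull S. f x)"
    by (rule SUP_subset_mono) (simp_all add: hull_subset)
qed

definition rad_extension :: "('a::preordered_comm_semiring \<Rightarrow> 'f::frame) \<Rightarrow> 'a rad \<Rightarrow> 'f" where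
  "rad_extension f I = (SUP x\<in>Rep_rad I. f x)"

lemma frame_hom_rad_extension:
  fixes f :: "'a::preordered_comm_semiring \<Rightarrow> 'f::frame"
  assumes f: "subadditive_morphism (\<le>) 0 1 (+) (*) (\<le>) bot top sup inf f"
  shows "frame_hom (rad_extension f)"
proof (rule frame_homI)
  fix X :: "'a rad set"
  have "rad_extension f (Sup X) = (SUP x\<in>(\<Union>I\<in>X. Rep_rad I). f x)"
    unfolding rad_extension_def Sup_rad.rep_eq by (rule SUP_radical_ideal_hull[OF f])
  also have "\<dots> = Sup (rad_extension f ` X)"
    by (simp add: rad_extension_def SUP_UNION)
  finally show "rad_extension f (Sup X) = Sup (rad_extension f ` X)" .
next
  have "f 1 \<le> rad_extension f top"
    unfolding rad_extension_def top_rad.rep_eq by (rule SUP_upper) simp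
  then show "rad_extension f top = top"
    by (simp add: subadditive_morphism.one[OF f] top_unique)
next
  fix I J :: "'a rad"
  show "rad_extension f (inf I J) = inf (rad_extension f I) (rad_extension f J)"
  proof (rule antisym)
    show "rad_extension f (inf I J) \<le> inf (rad_extension f I) (rad_extension f J)"
      unfolding rad_extension_def inf_rad.rep_eq by (intro le_infI SUP_subset_mono) auto
    have "inf (f x) (f y) \<le> rad_extension f (inf I J)" if "x \<in> Rep_rad I" "y \<in> Rep_rad J" for x y
    proof -
      \<comment> \<open>Absorption puts the product in both ideals, so its image, which is the meet
        of \<open>f x\<close> and \<open>f y\<close>, takes part in the join over
        \<open>inf I J\<close>.\<close>
      have "x * y \<in> Rep_rad (inf I J)"
        using that radical_ideal_mult[of "Rep_rad I" x y] radical_ideal_mult[of "Rep_rad J" x y]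
          Rep_rad[of I] Rep_rad[of J]
        by (simp add: inf_rad.rep_eq)
      then have "f (x * y) \<le> rad_extension f (inf I J)"
        unfolding rad_extension_def by (rule SUP_upper)
      then show ?thesis
        by (simp add: subadditive_morphism.mult[OF f])
    qed
    then show "inf (rad_extension f I) (rad_extension f J) \<le> rad_extension f (inf I J)"
      \<comment> \<open>The value at \<open>inf I J\<close> stays folded: it is the bound
        \<open>c\<close> of \<open>Sup_inf_Sup_le\<close>.\<close>
      unfolding rad_extension_def[of f I] rad_extension_def[of f J]
      by (intro Sup_inf_Sup_le) auto
  qed
qed

lemma Rep_rad_radical_ideal_hull: "Rep_rad (radical (ideal hull S)) = radical_ideal hull S"
  by (simp add: radical.rep_eq radical_ideal_hull_ideal_hull)

lemma rad_extension_radical: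
  fixes f :: "'a::preordered_comm_semiring \<Rightarrow> 'f::frame"
  assumes "subadditive_morphism (\<le>) 0 1 (+) (*) (\<le>) bot top sup inf f"
  shows "rad_extension f (radical (ideal hull {x})) = f x"
  by (simp add: rad_extension_def Rep_rad_radical_ideal_hull SUP_radical_ideal_hull[OF assms])

text \<open>Each member of \<open>I\<close> lies in the radical ideal it generates, which by
  minimality stays inside \<open>I\<close>.\<close>

lemma rad_eq_SUP_radical: "I = (SUP x\<in>Rep_rad I. radical (ideal hull {x}))"
proof (rule antisym)
  have "Rep_rad I \<subseteq> (\<Union>x\<in>Rep_rad I. radical_ideal hull {x})"
    by (auto intro: hull_inc)
  also have "\<dots> \<subseteq> Rep_rad (SUP x\<in>Rep_rad I. radical (ideal hull {x}))"
    unfolding Sup_rad.rep_eq image_image Rep_rad_radical_ideal_hull by (rule hull_subset)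
  finally show "I \<le> (SUP x\<in>Rep_rad I. radical (ideal hull {x}))"
    unfolding less_eq_rad.rep_eq .
  show "(SUP x\<in>Rep_rad I. radical (ideal hull {x})) \<le> I"
  proof (rule SUP_least)
    fix x assume "x \<in> Rep_rad I"
    then have "radical_ideal hull {x} \<subseteq> Rep_rad I"
      using Rep_rad[of I] by (intro hull_minimal) simp_all
    then show "radical (ideal hull {x}) \<le> I"
      by (simp add: less_eq_rad.rep_eq Rep_rad_radical_ideal_hull)
  qed
qed

theorem theorem5p1:
  fixes f :: "'a::preordered_comm_semiring \<Rightarrow> 'f::frame"
  assumes "subadditive_morphism (\<le>) 0 1 (+) (*) (\<le>) bot top sup inf f"
  shows "\<exists>!g :: 'a rad \<Rightarrow> 'f. frame_hom g \<and> (\<forall>x. g (radical (ideal hull {x})) = f x)"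
proof (rule ex1I)
  show "frame_hom (rad_extension f) \<and> (\<forall>x. rad_extension f (radical (ideal hull {x})) = f x)"
    using frame_hom_rad_extension[OF assms] rad_extension_radical[OF assms] by blast
next
  fix g :: "'a rad \<Rightarrow> 'f"
  assume g: "frame_hom g \<and> (\<forall>x. g (radical (ideal hull {x})) = f x)"
  show "g = rad_extension f"
  proof
    fix I :: "'a rad"
    have "g I = g (SUP x\<in>Rep_rad I. radical (ideal hull {x}))"
      using rad_eq_SUP_radical[of I] by (rule arg_cong)
    \<comment> \<open>Preservation of joins reduces \<open>g\<close> to its prescribed values on the
      generators.\<close>
    also have "\<dots> = (SUP x\<in>Rep_rad I. g (radical (ideal hull {x})))"
      using g by (simp add: frame_hom_def image_image)
    also have "\<dots> = rad_extension f I"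
      using g by (simp add: rad_extension_def)
    finally show "g I = rad_extension f I" .
  qed
qed

end
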